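(* Let $\mathcal S$ satisfy Axioms I–IV, and let $\mathcal P$ be a two-dimensional subspace of $\mathcal S$ of rank $R=2$. Then there is a one-one correspondence $x\leftrightarrow\bar x$ between the points $x$ of $\mathcal P$ and the points $\bar x$ of $\mathbb{C}P^1$ such that for all $x_1,x_2\in\mathcal P$ $$x_1(x_2)=|\hat x_1^*\cdot\hat x_2|^2,\qquad \hat x=\bar x/|\bar x|,$$ where $\hat x\in\mathbb C^2$ is a unit vector of homogeneous coordinates representing $\bar x$ and $\hat x_1^*\cdot\hat x_2$ is the Hermitian inner product.
   Context: Setting: $\mathcal S$ is a set with a function $p:\mathcal S\times\mathcal S\to[0,1]$; write $x(y)=p(x,y)$ and identify an element $u\in\mathcal S$ with the function $u(\cdot)$ on $\mathcal S$. Elements $u,v$ are orthogonal if $u(v)=0$. Put $d(x,y)=\sup_{z\in\mathcal S}|x(z)-y(z)|$. A frame in $\mathcal S$ is a maximal set of mutually orthogonal elements of $\mathcal S$. Axiom I: for all $w,z\in\mathcal S$, $w(z)=1$ if and only if $w=z$, and $w(z)=z(w)$. Axiom II: $\mathcal S$ is compact in the metric $d$. Axiom III: for every $a\in\mathcal S$ and every frame $\{x_1,x_2,\dots\}$ in $\mathcal S$, $\sum_j a(x_j)=1$. Axiom IV: given any two distinct $a,b\in\mathcal S$ there exist orthogonal $c,c'\in\mathcal S$ and a number $0<\alpha<1$ such that $a(c)\,c+a(c')\,c'=\alpha a+(1-\alpha)b$ as functions on $\mathcal S$. A two-dimensional subspace is a set of the form $\{z\in\mathcal S: x(z)+x'(z)=1\}$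 with $x,x'\in\mathcal S$ orthogonal. Two elements $x,y$ are mutually equatorial if $x(y)=\frac12$. The rank $R$ of a two-dimensional subspace is one less than the maximum number of elements in a mutually equatorial subset of it. *)

theory Defs
  imports "HOL-Analysis.Analysis"
begin

definition orthog :: "('a \<Rightarrow> 'a \<Rightarrow> real) \<Rightarrow> 'a \<Rightarrow> 'a \<Rightarrow> bool" where
  "orthog p u v \<longleftrightarrow> p u v = 0"

definition equatorial :: "('a \<Rightarrow> 'a \<Rightarrow> real) \<Rightarrow> 'a \<Rightarrow> 'a \<Rightarrow> bool" where
  "equatorial p x y \<longleftrightarrow> p x y = 1/2"

text \<open>The supremum is only meaningful for points of \<open>S\<close>; the value 0 elsewhere makes
  the library locale \<^locale>\<open>Metric_space\<close>, which constrains the distance on the whole type,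
  applicable (see \<open>Metric_space_sdist\<close>).\<close>

definition sdist :: "'a set \<Rightarrow> ('a \<Rightarrow> 'a \<Rightarrow> real) \<Rightarrow> 'a \<Rightarrow> 'a \<Rightarrow> real" where
  "sdist S p x y = (if x \<in> S \<and> y \<in> S then (SUP z\<in>S. \<bar>p x z - p y z\<bar>) else 0)"

definition orthog_set :: "'a set \<Rightarrow> ('a \<Rightarrow> 'a \<Rightarrow> real) \<Rightarrow> 'a set \<Rightarrow> bool" where
  "orthog_set S p F \<longleftrightarrow> F \<subseteq> S \<and> pairwise (orthog p) F"

definition frame :: "'a set \<Rightarrow> ('a \<Rightarrow> 'a \<Rightarrow> real) \<Rightarrow> 'a set \<Rightarrow> bool" where
  "frame S p F \<longleftrightarrow> orthog_set S p F \<and> (\<forall>G. orthog_set S p G \<and> F \<subseteq> G \<longrightarrow> G = F)"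

definition axiom_I :: "'a set \<Rightarrow> ('a \<Rightarrow> 'a \<Rightarrow> real) \<Rightarrow> bool" where
  "axiom_I S p \<longleftrightarrow> (\<forall>w\<in>S. \<forall>z\<in>S. (p w z = 1 \<longleftrightarrow> w = z) \<and> p w z = p z w)"

definition axiom_II :: "'a set \<Rightarrow> ('a \<Rightarrow> 'a \<Rightarrow> real) \<Rightarrow> bool" where
  "axiom_II S p \<longleftrightarrow> compact_space (Metric_space.mtopology S (sdist S p))"

text \<open>No finiteness or countability of frames is presupposed, hence \<^const>\<open>has_sum\<close>.\<close>

definition axiom_III :: "'a set \<Rightarrow> ('a \<Rightarrow> 'a \<Rightarrow> real) \<Rightarrow> bool" where
  "axiom_III S p \<longleftrightarrow> (\<forall>a\<in>S. \<forall>F. frame S p F \<longrightarrow> ((\<lambda>x. p a x) has_sum 1) F)"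

definition axiom_IV :: "'a set \<Rightarrow> ('a \<Rightarrow> 'a \<Rightarrow> real) \<Rightarrow> bool" where
  "axiom_IV S p \<longleftrightarrow> (\<forall>a\<in>S. \<forall>b\<in>S. a \<noteq> b \<longrightarrow>
     (\<exists>c\<in>S. \<exists>c'\<in>S. \<exists>\<alpha>::real. orthog p c c' \<and> 0 < \<alpha> \<and> \<alpha> < 1 \<and>
        (\<forall>z\<in>S. p a c * p c z + p a c' * p c' z = \<alpha> * p a z + (1 - \<alpha>) * p b z)))"

definition two_dim_subspace :: "'a set \<Rightarrow> ('a \<Rightarrow> 'a \<Rightarrow> real) \<Rightarrow> 'a set \<Rightarrow> bool" where
  "two_dim_subspace S p P \<longleftrightarrow>
     (\<exists>x\<in>S. \<exists>x'\<in>S. orthog p x x' \<and> P = {z \<in> S. p x z + p x' z = 1})"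

text \<open>\<open>has_rank p P R\<close>: the maximum number of elements in a mutually equatorial subset of \<open>P\<close>
  exists and equals \<open>R + 1\<close>. A relation avoids junk values where there is no maximum.\<close>

definition has_rank :: "('a \<Rightarrow> 'a \<Rightarrow> real) \<Rightarrow> 'a set \<Rightarrow> nat \<Rightarrow> bool" where
  "has_rank p P R \<longleftrightarrow>
     (\<exists>A\<subseteq>P. pairwise (equatorial p) A \<and> finite A \<and> card A = R + 1) \<and>
     (\<forall>A\<subseteq>P. pairwise (equatorial p) A \<longrightarrow> finite A \<and> card A \<le> R + 1)"

text \<open>A point of \<open>CP1\<close> is the set of all its vectors of homogeneous coordinates.\<close>

definition proportional :: "((complex^2) \<times> (complex^2)) set" where
  "proportional = {(v, w). v \<noteq> 0 \<and> w \<noteq> 0 \<and> (\<exists>c. c \<noteq> 0 \<and> w = c *s v)}"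

definition CP1 :: "(complex^2) set set" where
  "CP1 = (- {0}) // proportional"

definition herm :: "complex^2 \<Rightarrow> complex^2 \<Rightarrow> complex" where
  "herm u v = (\<Sum>i\<in>UNIV. cnj (u $ i) * v $ i)"

lemma equiv_proportional: "equiv (- {0}) proportional"
proof (rule equivI)
  show "proportional \<subseteq> (- {0}) \<times> (- {0})"
    by (auto simp: proportional_def)
  show "refl_on (- {0}) proportional"
    by (auto simp: refl_on_def proportional_def intro!: exI[of _ 1])
  show "sym proportional"
  proof (rule symI)
    fix v w assume "(v, w) \<in> proportional"
    then obtain c where c: "c \<noteq> 0" "w = c *s v" "v \<noteq> 0" "w \<noteq> 0"
      by (auto simp: proportional_def)
    then have "v = inverse c *s w" by (simp add: vector_smult_assoc)
    moreover have "inverse c \<noteq> 0" using c by simp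
    ultimately show "(w, v) \<in> proportional"
      unfolding proportional_def using c(3,4) by blast
  qed
  show "trans proportional"
  proof (rule transI)
    fix u v w assume "(u, v) \<in> proportional" "(v, w) \<in> proportional"
    then obtain c d where cd: "c \<noteq> 0" "d \<noteq> 0" "v = c *s u" "w = d *s v" "u \<noteq> 0" "w \<noteq> 0"
      by (auto simp: proportional_def)
    then have "w = (d * c) *s u" by (simp add: vector_smult_assoc)
    moreover have "d * c \<noteq> 0" using cd by simp
    ultimately show "(u, w) \<in> proportional"
      unfolding proportional_def using cd(5,6) by blast
  qed
qed

lemma Metric_space_sdist:
  assumes p01: "\<And>x y. x \<in> S \<Longrightarrow> y \<in> S \<Longrightarrow> 0 \<le> p x y \<and> p x y \<le> 1"
    and I: "axiom_I S p"
  shows "Metric_space S (sdist S p)"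
proof
  have le1: "\<bar>p x z - p y z\<bar> \<le> 1" if "x \<in> S" "y \<in> S" "z \<in> S" for x y z
    using p01[of x z] p01[of y z] that by linarith
  have bdd: "bdd_above ((\<lambda>z. \<bar>p x z - p y z\<bar>) ` S)" if "x \<in> S" "y \<in> S" for x y
    using le1 that by (intro bdd_aboveI[where M = 1]) auto
  have up: "\<bar>p x z - p y z\<bar> \<le> sdist S p x y" if "x \<in> S" "y \<in> S" "z \<in> S" for x y z
    using that cSUP_upper[OF _ bdd, of z x y] by (simp add: sdist_def)
  show nn: "0 \<le> sdist S p x y" for x y
  proof (cases "x \<in> S \<and> y \<in> S")
    case True
    then show ?thesis using up[of x y x] by linarith
  next
    case False
    then have "sdist S p x y = 0" unfolding sdist_def by (rule if_not_P)
    then show ?thesis by simp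
  qed
  show "sdist S p x y = sdist S p y x" for x y
    by (simp add: sdist_def abs_minus_commute conj_commute)
  show "(sdist S p x y = 0) = (x = y)" if "x \<in> S" "y \<in> S" for x y
  proof
    assume "sdist S p x y = 0"
    then have "p x x = p y x" using up[of x y x] that by simp
    then show "x = y" using I that unfolding axiom_I_def by metis
  next
    assume "x = y"
    moreover have "S \<noteq> {}" using that by blast
    ultimately show "sdist S p x y = 0" by (simp add: sdist_def)
  qed
  show "sdist S p x z \<le> sdist S p x y + sdist S p y z" if "x \<in> S" "y \<in> S" "z \<in> S" for x y z
  proof -
    have "(SUP w\<in>S. \<bar>p x w - p z w\<bar>) \<le> sdist S p x y + sdist S p y z"
    proof (rule cSUP_least)
      show "S \<noteq> {}" using that by blast
      fix w assume w: "w \<in> S"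
      show "\<bar>p x w - p z w\<bar> \<le> sdist S p x y + sdist S p y z"
        using up[OF that(1,2) w] up[OF that(2,3) w] by linarith
    qed
    then show ?thesis using that by (simp add: sdist_def)
  qed
qed

end

theory Submission
  imports Defs
begin

text \<open>
  Put \<open>k x y = 2 x(y) - 1\<close> on \<open>P\<close> and regard a point \<open>x\<close> as the function \<open>k x\<close>. Counting
  along frames gives every point of \<open>P\<close> an antipode \<open>x'\<close> with \<open>k x' = - k x\<close>. In Axiom IV
  symmetry forces \<open>\<alpha> = 1/2\<close>, and for two points of \<open>P\<close> it says that \<open>k a + k b\<close> is a multiple
  of some \<open>k c\<close>. With compactness the real multiples of points are then closed under addition,
  so they form a vector space on which \<open>k\<close> is an inner product with unit sphere \<open>P\<close>. Mutually
  equatorial sets are orthonormal sets, hence rank 2 means dimension 3. Thus \<open>P\<close> is the sphere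
  \<open>S\<^sup>2\<close>, and the Bloch vector (Hopf map) of a vector in \<open>\<complex>\<^sup>2\<close> identifies it with the projective
  line.
\<close>

section \<open>Frames, compactness and convex combinations in the whole space\<close>

locale transition_space =
  fixes S :: "'a set" and p :: "'a \<Rightarrow> 'a \<Rightarrow> real"
  assumes bounds: "\<And>x y. x \<in> S \<Longrightarrow> y \<in> S \<Longrightarrow> 0 \<le> p x y \<and> p x y \<le> 1"
    and axI: "axiom_I S p" and axII: "axiom_II S p"
    and axIII: "axiom_III S p" and axIV: "axiom_IV S p"
begin

lemma p_eq_1: "x \<in> S \<Longrightarrow> y \<in> S \<Longrightarrow> p x y = 1 \<longleftrightarrow> x = y"
  using axI by (auto simp: axiom_I_def)

lemma p_sym: "x \<in> S \<Longrightarrow> y \<in> S \<Longrightarrow> p x y = p y x"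
  using axI by (auto simp: axiom_I_def)

text \<open>Zorn's lemma: two members of the union of a chain already lie in one set of the chain,
  so the union is again orthogonal.\<close>

lemma orthog_set_extends_to_frame:
  assumes "orthog_set S p F"
  obtains F' where "frame S p F'" "F \<subseteq> F'"
proof -
  let ?A = "{G. orthog_set S p G \<and> F \<subseteq> G}"
  have "\<exists>M\<in>?A. \<forall>X\<in>?A. M \<subseteq> X \<longrightarrow> X = M"
  proof (rule subset_Zorn_nonempty)
    show "?A \<noteq> {}" using assms by blast
    fix C assume C: "C \<noteq> {}" "subset.chain ?A C"
    have "pairwise (orthog p) (\<Union>C)"
    proof (rule pairwiseI)
      fix u v assume "u \<in> \<Union>C" "v \<in> \<Union>C" "u \<noteq> v"
      then obtain U V where UV: "U \<in> C" "V \<in> C" "u \<in> U" "v \<in> V" by blast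
      then have "U \<subseteq> V \<or> V \<subseteq> U" using C(2) by (auto simp: subset_chain_def)
      then obtain W where "W \<in> C" "u \<in> W" "v \<in> W" using UV by blast
      moreover then have "pairwise (orthog p) W"
        using C(2) by (auto simp: subset_chain_def orthog_set_def)
      ultimately show "orthog p u v" using \<open>u \<noteq> v\<close> by (auto simp: pairwise_def)
    qed
    moreover have "\<Union>C \<subseteq> S" "F \<subseteq> \<Union>C"
      using C by (auto simp: subset_chain_def orthog_set_def) blast
    ultimately show "\<Union>C \<in> ?A" by (simp add: orthog_set_def)
  qed
  then obtain M where M: "M \<in> ?A" and max: "\<forall>X\<in>?A. M \<subseteq> X \<longrightarrow> X = M" ..
  show thesis
  proof
    show "frame S p M" unfolding frame_def using M max by (metis mem_Collect_eq subset_trans)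
    show "F \<subseteq> M" using M by simp
  qed
qed

lemma frame_has_sum: "frame S p F \<Longrightarrow> a \<in> S \<Longrightarrow> (p a has_sum 1) F"
  using axIII by (auto simp: axiom_III_def)

lemma frame_subset: "frame S p F \<Longrightarrow> F \<subseteq> S"
  by (auto simp: frame_def orthog_set_def)

lemma frame_orthog: "frame S p F \<Longrightarrow> u \<in> F \<Longrightarrow> v \<in> F \<Longrightarrow> u \<noteq> v \<Longrightarrow> p u v = 0"
  by (auto simp: frame_def orthog_set_def pairwise_def orthog_def)

text \<open>Compactness of a metric space gives a convergent subsequence, and a supremum distance
  bounds the difference at every single \<open>z\<close>.\<close>

lemma pointwise_convergent_subseq:
  fixes s :: "nat \<Rightarrow> 'a"
  assumes "range s \<subseteq> S"
  obtains l r where "l \<in> S" "strict_mono r" "\<And>z. z \<in> S \<Longrightarrow> (\<lambda>n. p (s (r n)) z) \<longlonglongrightarrow> p l z"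
proof -
  interpret M: Metric_space S "sdist S p"
    by (rule Metric_space_sdist[OF bounds axI])
  obtain l r where lr: "l \<in> S" "strict_mono r"
    and lim: "limitin M.mtopology (s \<circ> r) l sequentially"
    using axII[unfolded axiom_II_def M.compact_space_sequentially, rule_format, OF assms]
    by (elim exE conjE)
  have "(\<lambda>n. p (s (r n)) z) \<longlonglongrightarrow> p l z" if z: "z \<in> S" for z
  proof (rule LIMSEQ_I)
    fix e :: real assume "0 < e"
    then obtain N where N: "\<And>n. n \<ge> N \<Longrightarrow> sdist S p (s (r n)) l < e"
      using lim unfolding M.limit_metric_sequentially o_apply by metis
    have "\<bar>p (s (r n)) z - p l z\<bar> < e" if "n \<ge> N" for n
    proof -
      have sn: "s (r n) \<in> S" using assms by auto
      have "bdd_above ((\<lambda>w. \<bar>p (s (r n)) w - p l w\<bar>) ` S)"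
      proof (rule bdd_aboveI[where M = 1])
        fix y assume "y \<in> (\<lambda>w. \<bar>p (s (r n)) w - p l w\<bar>) ` S"
        then obtain w where "w \<in> S" "y = \<bar>p (s (r n)) w - p l w\<bar>" by blast
        then show "y \<le> 1" using bounds[OF sn, of w] bounds[OF lr(1), of w] by linarith
      qed
      then have "\<bar>p (s (r n)) z - p l z\<bar> \<le> sdist S p (s (r n)) l"
        using cSUP_upper[OF z] sn lr(1) by (simp add: sdist_def)
      then show ?thesis using N[OF that] by linarith
    qed
    then show "\<exists>no. \<forall>n\<ge>no. norm (p (s (r n)) z - p l z) < e" by auto
  qed
  then show thesis using lr that by blast
qed

text \<open>Evaluating the axiom at \<open>c\<close> and \<open>c'\<close> shows that
  \<open>a\<close> and \<open>b\<close> have the same coefficients. The left side then takes equal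
  values at \<open>a\<close> and \<open>b\<close>, and comparing the right sides forces \<alpha> to
  be 1/2.\<close>

lemma axiom_IV_evaluated:
  assumes "a \<in> S" "b \<in> S" "a \<noteq> b"
  obtains c c' where "c \<in> S" "c' \<in> S" "p c c' = 0" "p a c = p b c" "p a c' = p b c'"
    "\<And>z. z \<in> S \<Longrightarrow> p a c * p c z + p a c' * p c' z = (p a z + p b z) / 2"
proof -
  obtain c c' \<alpha> where c: "c \<in> S" "c' \<in> S" "p c c' = 0" and \<alpha>: "0 < \<alpha>" "\<alpha> < 1"
    and eq: "\<And>z. z \<in> S \<Longrightarrow> p a c * p c z + p a c' * p c' z = \<alpha> * p a z + (1 - \<alpha>) * p b z"
    using axIV assms unfolding axiom_IV_def orthog_def by blast
  have s: "p c c = 1" "p c' c' = 1" "p c' c = 0" "p a a = 1" "p b b = 1" "p b a = p a b"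
    "p c a = p a c" "p c' a = p a c'" "p c b = p b c" "p c' b = p b c'"
    using c assms p_eq_1 p_sym by simp_all
  have "(1 - \<alpha>) * (p a c - p b c) = 0" "(1 - \<alpha>) * (p a c' - p b c') = 0"
    using eq[OF c(1)] eq[OF c(2)] s c(3) by (simp_all add: algebra_simps)
  then have ab: "p a c = p b c" "p a c' = p b c'" using \<alpha> by auto
  have "(2 * \<alpha> - 1) * (1 - p a b) = 0"
    using eq[OF assms(1)] eq[OF assms(2)] s ab by (simp add: algebra_simps)
  then have \<alpha>2: "\<alpha> = 1/2" using p_eq_1[OF assms(1,2)] assms(3) by auto
  then have "p a c * p c z + p a c' * p c' z = (p a z + p b z) / 2" if "z \<in> S" for z
    using eq[OF that] by (simp add: \<alpha>2 field_simps)
  then show thesis using c ab that by blast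
qed

end

section \<open>Antipodes, midpoints and limits in a two-dimensional subspace\<close>

text \<open>\<open>G\<close> is the rest of a fixed frame through \<open>x\<close> and
  \<open>x'\<close>; through it the axiom on frame sums becomes usable on \<open>P\<close>.\<close>

locale two_dim = transition_space +
  fixes P x x' G
  assumes xS: "x \<in> S" "x' \<in> S" and xx': "p x x' = 0"
    and P_def: "P = {z \<in> S. p x z + p x' z = 1}"
    and frame: "frame S p (insert x (insert x' G))" and x_notin: "x \<notin> G" "x' \<notin> G"
begin

lemma P_sub: "z \<in> P \<Longrightarrow> z \<in> S"
  by (simp add: P_def)

lemma x_neq: "x \<noteq> x'"
  using xx' xS p_eq_1[of x x] by auto

lemma G_sub: "g \<in> G \<Longrightarrow> g \<in> S"
  using frame_subset[OF frame] by auto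

lemma G_has_sum:
  assumes "a \<in> S" shows "(p a has_sum (1 - p a x - p a x')) G"
proof -
  have fin: "(p a has_sum (p a x + p a x')) {x, x'}"
    using x_neq by (intro has_sum_finiteI) auto
  have "(p a has_sum (1 - (p a x + p a x'))) (insert x (insert x' G) - {x, x'})"
    by (rule has_sum_Diff[OF frame_has_sum[OF frame assms] fin]) auto
  moreover have "insert x (insert x' G) - {x, x'} = G" using x_notin by auto
  ultimately show ?thesis by (simp add: algebra_simps)
qed

text \<open>The values \<open>p z g\<close> are nonnegative with sum
  \<open>1 - p z x - p z x'\<close>, so this number is 0 exactly if all of them vanish.\<close>

lemma P_iff_orthog_G:
  assumes "z \<in> S" shows "z \<in> P \<longleftrightarrow> (\<forall>g\<in>G. p z g = 0)"
proof
  assume "z \<in> P"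
  then have "1 - p z x - p z x' = 0"
    using p_sym[OF assms] xS by (simp add: P_def)
  then have "(p z has_sum 0) G" using G_has_sum[OF assms] by simp
  moreover have "\<And>g. g \<in> G \<Longrightarrow> 0 \<le> p z g" using bounds[OF assms G_sub] by blast
  ultimately show "\<forall>g\<in>G. p z g = 0"
    using finite_sum_le_has_sum[of "p z" G 0 "{g}" for g] by (force intro: order.antisym)
next
  assume "\<forall>g\<in>G. p z g = 0"
  then have "(p z has_sum 0) G" by (intro has_sum_0) auto
  then have "1 - p z x - p z x' = 0"
    using G_has_sum[OF assms] has_sum_unique by blast
  then show "z \<in> P" using assms p_sym[OF assms] xS by (simp add: P_def)
qed

text \<open>Completing \<open>insert z G\<close> to a frame adds a set \<open>H\<close> on which \<open>p x + p x'\<close> is constantly 1 and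
  has sum 1, so \<open>H\<close> is a singleton.\<close>

lemma antipode_exists:
  assumes z: "z \<in> P"
  obtains z' where "z' \<in> P" "p z z' = 0"
    "\<And>a. a \<in> S \<Longrightarrow> p a z + p a z' = p a x + p a x'"
proof -
  have zS: "z \<in> S" using P_sub z .
  have zG: "p z g = 0" "p g z = 0" if "g \<in> G" for g
    using P_iff_orthog_G[OF zS] z that p_sym[OF zS G_sub] by auto
  have z_notin: "z \<notin> G" using zG p_eq_1[OF zS zS] by force
  have "orthog_set S p (insert z G)"
    using frame zS zG by (auto simp: frame_def orthog_set_def pairwise_insert orthog_def)
  then obtain F where F: "frame S p F" "insert z G \<subseteq> F"
    by (rule orthog_set_extends_to_frame)
  define H where "H = F - insert z G"
  have H_P: "h \<in> P" "p z h = 0" if "h \<in> H" for h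
  proof -
    have hS: "h \<in> S" using that frame_subset[OF F(1)] by (auto simp: H_def)
    have "p h g = 0" if "g \<in> G" for g
      using \<open>h \<in> H\<close> that F frame_orthog[OF F(1)] by (auto simp: H_def)
    then show "h \<in> P" using P_iff_orthog_G[OF hS] by blast
    show "p z h = 0" using that F frame_orthog[OF F(1)] by (auto simp: H_def)
  qed
  have H_sum: "(p a has_sum (p a x + p a x' - p a z)) H" if "a \<in> S" for a
  proof -
    have "(p a has_sum (p a z + (1 - p a x - p a x'))) ({z} \<union> G)"
      by (rule has_sum_Un_disjoint[OF _ G_has_sum[OF that]])
        (use z_notin in \<open>auto intro: has_sum_finiteI\<close>)
    then have "(p a has_sum (1 - (p a z + (1 - p a x - p a x')))) (F - ({z} \<union> G))"
      using F by (intro has_sum_Diff frame_has_sum that) auto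
    then show ?thesis by (simp add: H_def algebra_simps)
  qed
  have xx: "p x x = 1" "p x' x' = 1" "p x' x = 0" "p x z + p x' z = 1"
    using xS xx' p_eq_1 p_sym z by (auto simp: P_def)
  \<comment> \<open>\<open>H_sum\<close> is added for \<open>x\<close> and for \<open>x'\<close>.
    The total is 2 less the contribution of \<open>z\<close>, which is 1 because \<open>z\<close>
    lies in \<open>P\<close>.\<close>
  have "((\<lambda>h. p x h + p x' h) has_sum ((p x x + p x x' - p x z) + (p x' x + p x' x' - p x' z))) H"
    by (intro has_sum_add H_sum xS)
  moreover have "p x h + p x' h = 1" if "h \<in> H" for h
    using H_P[OF that] by (simp add: P_def)
  moreover have "(p x x + p x x' - p x z) + (p x' x + p x' x' - p x' z) = 1"
    using xx xx' by simp
  ultimately have one: "((\<lambda>h. 1::real) has_sum 1) H"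
    by (metis (no_types, lifting) has_sum_cong)
  have "H \<noteq> {}"
    using one has_sum_unique[OF one] by (metis has_sum_empty zero_neq_one)
  moreover have "h = h'" if "h \<in> H" "h' \<in> H" for h h'
    using finite_sum_le_has_sum[OF one, of "{h, h'}"] that by (cases "h = h'") auto
  ultimately obtain z' where H: "H = {z'}" by blast
  have "p a z + p a z' = p a x + p a x'" if "a \<in> S" for a
  proof -
    have "(p a has_sum p a z') H" by (simp add: H has_sum_finiteI)
    then show ?thesis using has_sum_unique[OF H_sum[OF that]] by fastforce
  qed
  then show thesis using that H_P H by blast
qed

lemma sum_on_P: "a \<in> P \<Longrightarrow> p a x + p a x' = 1"
  using p_sym[OF _ xS(1), of a] p_sym[OF _ xS(2), of a] by (simp add: P_def)

text \<open>Antipodes are unique: if \<open>d\<close> is the antipode of \<open>c\<close>, then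
  \<open>p c' c + p c' d = 1\<close> with \<open>p c' c = 0\<close> gives \<open>p c' d = 1\<close>,
  so \<open>c' = d\<close>.\<close>

lemma orthog_complementary:
  assumes "c \<in> P" "c' \<in> P" "p c c' = 0" "z \<in> P"
  shows "p c z + p c' z = 1"
proof -
  obtain d where d: "d \<in> P" "p c d = 0"
    and comp: "\<And>a. a \<in> S \<Longrightarrow> p a c + p a d = p a x + p a x'"
    using antipode_exists[OF assms(1)] by blast
  have "p c' d = 1"
    using comp[of c'] assms sum_on_P[of c'] p_sym[of c c'] P_sub by force
  then have "c' = d" using p_eq_1 assms d P_sub by blast
  then show ?thesis using comp[of z] sum_on_P[of z] assms P_sub p_sym by metis
qed

text \<open>The affine rescaling under which equal, equatorial and orthogonal points get 1, 0 and
  -1, as for the inner product of unit vectors.\<close>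

definition k :: "'a \<Rightarrow> 'a \<Rightarrow> real" where
  "k a b = 2 * p a b - 1"

text \<open>The points \<open>c\<close> and \<open>c'\<close> of Axiom IV turn out to lie in
  \<open>P\<close>. Being orthogonal they are antipodal there, so both terms are expressible by
  \<open>k c\<close>.\<close>

lemma midpoint:
  assumes a: "a \<in> P" and b: "b \<in> P"
  shows "\<exists>r. \<exists>c\<in>P. \<forall>z\<in>P. k a z + k b z = r * k c z"
proof (cases "a = b")
  case True
  then show ?thesis using a by (intro exI[of _ 2] bexI[of _ a]) auto
next
  case False
  have S: "a \<in> S" "b \<in> S" using a b P_sub by auto
  obtain c c' where c: "c \<in> S" "c' \<in> S" "p c c' = 0"
    and ab: "p a c = p b c" "p a c' = p b c'"
    and eq: "\<And>z. z \<in> S \<Longrightarrow> p a c * p c z + p a c' * p c' z = (p a z + p b z) / 2"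
    using axiom_IV_evaluated[OF S False] by blast
  have nn: "0 \<le> p a c" "0 \<le> p a c'" using bounds S c by auto
  \<comment> \<open>Both \<open>a\<close> and \<open>b\<close> are orthogonal to \<open>g\<close>,
    so a sum of two nonnegative terms is 0. A positive coefficient thus makes its point orthogonal
    to \<open>G\<close> and puts it in \<open>P\<close>.\<close>
  have G: "p a c * p c g + p a c' * p c' g = 0" "0 \<le> p c g" "0 \<le> p c' g" if "g \<in> G" for g
    using eq[OF G_sub[OF that]] P_iff_orthog_G a b S that bounds[OF c(1)] bounds[OF c(2)] G_sub
    by auto
  have "p c g = 0" if "p a c > 0" "g \<in> G" for g
    using G[OF that(2)] nn that(1)
    by (metis add_nonneg_eq_0_iff mult_nonneg_nonneg mult_eq_0_iff less_numeral_extra(3))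
  then have cP: "c \<in> P" if "p a c > 0" using P_iff_orthog_G[OF c(1)] that by blast
  have "p c' g = 0" if "p a c' > 0" "g \<in> G" for g
    using G[OF that(2)] nn that(1)
    by (metis add_nonneg_eq_0_iff mult_nonneg_nonneg mult_eq_0_iff less_numeral_extra(3))
  then have c'P: "c' \<in> P" if "p a c' > 0" using P_iff_orthog_G[OF c(2)] that by blast
  have e: "p a c * (p c x + p c x') + p a c' * (p c' x + p c' x') = 1"
    using eq[OF xS(1)] eq[OF xS(2)] sum_on_P[OF a] sum_on_P[OF b] by (simp add: algebra_simps)
  \<comment> \<open>If one coefficient vanished, the other would be 1, and \<open>a\<close> and
    \<open>b\<close> would both equal the remaining point.\<close>
  have "p a c \<noteq> 0"
  proof
    assume 0: "p a c = 0"
    with e nn have "p a c' > 0" by (metis add_0 less_eq_real_def mult_zero_left zero_neq_one)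
    with e 0 sum_on_P[OF c'P] have "p a c' = 1" by simp
    then show False using ab p_eq_1 S c False by metis
  qed
  moreover have "p a c' \<noteq> 0"
  proof
    assume 0: "p a c' = 0"
    with e nn have "p a c > 0" by (metis add.right_neutral less_eq_real_def mult_zero_left zero_neq_one)
    with e 0 sum_on_P[OF cP] have "p a c = 1" by simp
    then show False using ab p_eq_1 S c False by metis
  qed
  ultimately have cc: "c \<in> P" "c' \<in> P" using cP c'P nn by auto
  have sum1: "p a c' = 1 - p a c" using e sum_on_P cc by simp
  have "k a z + k b z = (4 * p a c - 2) * k c z" if "z \<in> P" for z
  proof -
    have c'z: "p c' z = 1 - p c z" using orthog_complementary[OF cc c(3) that] by simp
    have "p a z + p b z = 2 * (p a c * p c z + (1 - p a c) * (1 - p c z))"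
      using eq[OF P_sub[OF that]] unfolding c'z sum1 by simp
    then show ?thesis by (simp add: k_def algebra_simps)
  qed
  then show ?thesis using cc by blast
qed

text \<open>The limit stays in \<open>P\<close> because the equation defining \<open>P\<close>
  involves only the values at \<open>x\<close> and \<open>x'\<close> and passes to pointwise
  limits.\<close>

lemma k_convergent_subseq:
  fixes s :: "nat \<Rightarrow> 'a"
  assumes "range s \<subseteq> P"
  obtains l r where "l \<in> P" "strict_mono r" "\<And>z. z \<in> P \<Longrightarrow> (\<lambda>n. k (s (r n)) z) \<longlonglongrightarrow> k l z"
proof -
  obtain l r where lr: "l \<in> S" "strict_mono r"
    and lim: "\<And>z. z \<in> S \<Longrightarrow> (\<lambda>n. p (s (r n)) z) \<longlonglongrightarrow> p l z"
    using pointwise_convergent_subseq[of s] assms P_sub by blast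
  have "(\<lambda>n. p (s (r n)) x + p (s (r n)) x') \<longlonglongrightarrow> p l x + p l x'"
    by (intro tendsto_add lim xS)
  moreover have "p (s (r n)) x + p (s (r n)) x' = 1" for n
    using assms by (intro sum_on_P) auto
  ultimately have "p l x + p l x' = 1" by (simp add: LIMSEQ_const_iff)
  then have "l \<in> P" using lr p_sym xS by (simp add: P_def)
  moreover have "(\<lambda>n. k (s (r n)) z) \<longlonglongrightarrow> k l z" if "z \<in> P" for z
    unfolding k_def by (intro tendsto_intros lim P_sub that)
  ultimately show thesis using lr that by blast
qed

end

section \<open>The vector space of real multiples of points\<close>

locale spherical_kernel =
  fixes P :: "'a set" and k :: "'a \<Rightarrow> 'a \<Rightarrow> real"
  assumes k_bound: "\<And>x y. x \<in> P \<Longrightarrow> y \<in> P \<Longrightarrow> \<bar>k x y\<bar> \<le> 1"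
    and k_sym: "\<And>x y. x \<in> P \<Longrightarrow> y \<in> P \<Longrightarrow> k x y = k y x"
    and k_eq_1: "\<And>x y. x \<in> P \<Longrightarrow> y \<in> P \<Longrightarrow> k x y = 1 \<longleftrightarrow> x = y"
    and antipode: "\<And>x. x \<in> P \<Longrightarrow> \<exists>x'\<in>P. \<forall>z\<in>P. k x' z = - k x z"
    and midpoint: "\<And>a b. a \<in> P \<Longrightarrow> b \<in> P \<Longrightarrow> \<exists>r. \<exists>c\<in>P. \<forall>z\<in>P. k a z + k b z = r * k c z"
    and convergent_subseq: "\<And>s :: nat \<Rightarrow> 'a. range s \<subseteq> P \<Longrightarrow>
      \<exists>l\<in>P. \<exists>r. strict_mono r \<and> (\<forall>z\<in>P. (\<lambda>n. k (s (r n)) z) \<longlonglongrightarrow> k l z)"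
begin

text \<open>Vectors are encoded as functions that matter only on \<open>P\<close>; no separate
  vector space type is built.\<close>

definition ray :: "('a \<Rightarrow> real) \<Rightarrow> bool" where
  "ray w \<longleftrightarrow> (\<exists>r. \<exists>c\<in>P. \<forall>z\<in>P. w z = r * k c z)"

lemma ray_point: "x \<in> P \<Longrightarrow> ray (k x)"
  unfolding ray_def by (intro exI[of _ 1]) auto

lemma ray_scale:
  assumes "ray w" shows "ray (\<lambda>z. s * w z)"
proof -
  obtain r c where "c \<in> P" "\<And>z. z \<in> P \<Longrightarrow> w z = r * k c z"
    using assms unfolding ray_def by blast
  then show ?thesis unfolding ray_def by (intro exI[of _ "s * r"] bexI[of _ c]) auto
qed

text \<open>A negative factor is absorbed by passing to the antipode.\<close>

lemma ray_nonneg: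
  assumes "ray w"
  obtains r c where "0 \<le> r" "c \<in> P" "\<And>z. z \<in> P \<Longrightarrow> w z = r * k c z"
proof -
  obtain r c where rc: "c \<in> P" "\<And>z. z \<in> P \<Longrightarrow> w z = r * k c z"
    using assms unfolding ray_def by blast
  obtain c' where c': "c' \<in> P" "\<And>z. z \<in> P \<Longrightarrow> k c' z = - k c z"
    using antipode[OF rc(1)] by blast
  show thesis
  proof (cases "0 \<le> r")
    case True
    then show ?thesis using rc that by blast
  next
    case False
    then show ?thesis using that[of "- r" c'] rc c' by simp
  qed
qed

text \<open>The parameters \<open>t\<close> for which the point of the segment is a multiple of a point of \<open>P\<close> form a
  closed set, by compactness. It has no gaps: the midpoint rule, applied to the normalized ends of a
  gap, produces a parameter inside it.\<close>

lemma ray_segment: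
  assumes a: "a \<in> P" and b: "b \<in> P" and "k a b \<noteq> - 1" and t0: "t0 \<in> {0..1}"
  shows "ray (\<lambda>z. (1 - t0) * k a z + t0 * k b z)"
proof -
  define W where "W = (\<lambda>t z. (1 - t) * k a z + t * k b z)"
  define T where "T = {t \<in> {0..1}. ray (W t)}"
  have c: "- 1 < k a b" using k_bound[OF a b] assms(3) by linarith
  \<comment> \<open>The sum \<open>W t a + W t b = 1 + k a b\<close> is positive and independent of
    \<open>t\<close>, so the segment never meets the zero vector and can be normalized.\<close>
  have pos: "\<exists>r>0. \<exists>c\<in>P. \<forall>z\<in>P. W t z = r * k c z" if "t \<in> T" for t
  proof -
    have "ray (W t)" using that by (simp add: T_def)
    then obtain r c where rc: "0 \<le> r" "c \<in> P" "\<And>z. z \<in> P \<Longrightarrow> W t z = r * k c z"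
      using ray_nonneg by blast
    have "W t a + W t b = 1 + k a b"
      using k_eq_1[OF a a] k_eq_1[OF b b] k_sym[OF a b] by (simp add: W_def algebra_simps)
    moreover have "W t a + W t b = 0" if "r = 0"
      using rc(3)[OF a] rc(3)[OF b] that by simp
    ultimately have "0 < r" using c rc(1) by (cases "r = 0") auto
    then show ?thesis using rc(2,3) by blast
  qed
  have "closed T"
    unfolding closed_sequential_limits
  proof (intro allI impI, elim conjE)
    fix t l assume t: "\<forall>n. t n \<in> T" and l: "t \<longlonglongrightarrow> l"
    have "l \<in> {0..1}"
      using closed_sequentially[of "{0..1::real}" t l] t l by (auto simp: T_def)
    have "\<exists>q. snd q \<in> P \<and> (\<forall>z\<in>P. W (t n) z = fst q * k (snd q) z)" for n
      using t by (force simp: T_def ray_def)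
    then obtain q where q: "\<And>n. snd (q n) \<in> P \<and> (\<forall>z\<in>P. W (t n) z = fst (q n) * k (snd (q n)) z)"
      by metis
    define r c where "r n = fst (q n)" and "c n = snd (q n)" for n
    have c: "c n \<in> P" and rc: "z \<in> P \<Longrightarrow> W (t n) z = r n * k (c n) z" for n z
      using q by (auto simp: r_def c_def)
    obtain d m where d: "d \<in> P" "strict_mono m"
      and lim: "\<And>z. z \<in> P \<Longrightarrow> (\<lambda>n. k (c (m n)) z) \<longlonglongrightarrow> k d z"
      using convergent_subseq[of c] c by (auto simp: image_subset_iff)
    have tm: "(\<lambda>n. t (m n)) \<longlonglongrightarrow> l"
      using LIMSEQ_subseq_LIMSEQ[OF l d(2)] by (simp add: o_def)
    \<comment> \<open>Evaluating at \<open>c n\<close> itself recovers the factor, as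
      \<open>k (c n) (c n) = 1\<close>; so the factors converge along with the points.\<close>
    have r_eq: "r n = (1 - t n) * k (c n) a + t n * k (c n) b" for n
      using rc[OF c, of n n] k_eq_1[OF c c, of n n] k_sym[OF a c] k_sym[OF b c]
      by (simp add: W_def)
    have r_lim: "(\<lambda>n. r (m n)) \<longlonglongrightarrow> (1 - l) * k d a + l * k d b"
      unfolding r_eq by (intro tendsto_intros tm lim a b)
    have "W l z = ((1 - l) * k d a + l * k d b) * k d z" if "z \<in> P" for z
    proof (rule LIMSEQ_unique)
      show "(\<lambda>n. W (t (m n)) z) \<longlonglongrightarrow> W l z"
        unfolding W_def by (intro tendsto_intros tm)
      show "(\<lambda>n. W (t (m n)) z) \<longlonglongrightarrow> ((1 - l) * k d a + l * k d b) * k d z"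
        unfolding rc[OF that] by (intro tendsto_intros r_lim lim that)
    qed
    then have "ray (W l)" unfolding ray_def using d(1) by blast
    then show "l \<in> T" using \<open>l \<in> {0..1}\<close> by (simp add: T_def)
  qed
  moreover have "bounded T" by (rule bounded_subset[of "{0..1}"]) (auto simp: T_def)
  ultimately have "compact T" by (simp add: compact_eq_bounded_closed)
  have "W 0 = k a" "W 1 = k b" by (simp_all add: W_def)
  then have "0 \<in> T" "1 \<in> T" using ray_point a b by (simp_all add: T_def)
  have "t0 \<in> T"
  proof (rule ccontr)
    assume "t0 \<notin> T"
    \<comment> \<open>The nearest parameters of \<open>T\<close> on either side of \<open>t0\<close>
      bound a gap.\<close>
    have "compact (T \<inter> {..t0})" "compact (T \<inter> {t0..})"
      using \<open>compact T\<close> by (auto intro: compact_Int_closed)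
    moreover have "0 \<in> T \<inter> {..t0}" "1 \<in> T \<inter> {t0..}" using \<open>0 \<in> T\<close> \<open>1 \<in> T\<close> t0 by auto
    ultimately obtain t1 t2
      where 1: "t1 \<in> T \<inter> {..t0}" "\<forall>t\<in>T \<inter> {..t0}. t \<le> t1"
        and 2: "t2 \<in> T \<inter> {t0..}" "\<forall>t\<in>T \<inter> {t0..}. t2 \<le> t"
      using compact_attains_sup compact_attains_inf by (metis empty_iff)
    have t1: "t1 \<in> T" "t1 \<le> t0" "\<And>t. t \<in> T \<Longrightarrow> t \<le> t0 \<Longrightarrow> t \<le> t1" using 1 by auto
    have t2: "t2 \<in> T" "t0 \<le> t2" "\<And>t. t \<in> T \<Longrightarrow> t0 \<le> t \<Longrightarrow> t2 \<le> t" using 2 by auto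
    have less: "t1 < t0" "t0 < t2" using t1 t2 \<open>t0 \<notin> T\<close> by (auto simp: less_le)
    obtain r1 c1 where 1: "0 < r1" "c1 \<in> P" "\<And>z. z \<in> P \<Longrightarrow> W t1 z = r1 * k c1 z"
      using pos[OF t1(1)] by blast
    obtain r2 c2 where 2: "0 < r2" "c2 \<in> P" "\<And>z. z \<in> P \<Longrightarrow> W t2 z = r2 * k c2 z"
      using pos[OF t2(1)] by blast
    \<comment> \<open>The weights \<open>r2\<close> and \<open>r1\<close> cancel the lengths of the
      two ends: \<open>r2 * W t1 + r1 * W t2\<close> is a multiple of
      \<open>k c1 + k c2\<close>.\<close>
    define t where "t = (t1 * r2 + t2 * r1) / (r1 + r2)"
    have "W t z = r1 * r2 / (r1 + r2) * (k c1 z + k c2 z)" if "z \<in> P" for z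
    proof -
      have t: "(r1 + r2) * t = t1 * r2 + t2 * r1" using 1(1) 2(1) by (simp add: t_def)
      have "(r1 + r2) * W t z = (r1 + r2) * k a z + ((r1 + r2) * t) * (k b z - k a z)"
        by (simp add: W_def algebra_simps)
      also have "\<dots> = r2 * W t1 z + r1 * W t2 z"
        unfolding t by (simp add: W_def algebra_simps)
      finally show ?thesis using 1 2 that by (simp add: field_simps)
    qed
    moreover have "ray (\<lambda>z. r1 * r2 / (r1 + r2) * (k c1 z + k c2 z))"
      using midpoint[OF 1(2) 2(2)] by (intro ray_scale) (simp add: ray_def)
    ultimately have "ray (W t)" by (simp add: ray_def)
    moreover have "t1 < t" "t < t2"
      using 1(1) 2(1) less by (auto simp: t_def field_simps)
    moreover have "0 \<le> t1" "t2 \<le> 1" using t1 t2 by (auto simp: T_def)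
    ultimately have "t \<in> T" by (simp add: T_def)
    then show False using t1(3) t2(3) \<open>t1 < t\<close> \<open>t < t2\<close> by fastforce
  qed
  then show ?thesis by (simp add: T_def W_def)
qed

text \<open>With nonnegative factors, the sum is \<open>r + s\<close> times a point of the segment
  joining \<open>k x\<close> and \<open>k y\<close>. Antipodal points, whose segment passes through
  0, are treated directly.\<close>

lemma ray_add:
  assumes "ray u" "ray v"
  shows "ray (\<lambda>z. u z + v z)"
proof -
  obtain r x where x: "0 \<le> r" "x \<in> P" "\<And>z. z \<in> P \<Longrightarrow> u z = r * k x z"
    using ray_nonneg[OF assms(1)] by blast
  obtain s y where y: "0 \<le> s" "y \<in> P" "\<And>z. z \<in> P \<Longrightarrow> v z = s * k y z"
    using ray_nonneg[OF assms(2)] by blast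
  consider "r + s = 0" | "k x y = - 1" | "0 < r + s" "k x y \<noteq> - 1" using x(1) y(1) by linarith
  then show ?thesis
  proof cases
    case 1
    then have "r = 0" "s = 0" using x(1) y(1) by linarith+
    then show ?thesis using x y unfolding ray_def by (intro exI[of _ 0] bexI[of _ x]) auto
  next
    case 2
    obtain x' where x': "x' \<in> P" "\<And>z. z \<in> P \<Longrightarrow> k x' z = - k x z"
      using antipode[OF x(2)] by blast
    then have "x' = y" using 2 k_eq_1[OF x'(1) y(2)] y(2) by simp
    then have "u z + v z = (r - s) * k x z" if "z \<in> P" for z
      using x(3) y(3) x'(2) that by (simp add: algebra_simps)
    then show ?thesis using x(2) unfolding ray_def by blast
  next
    case 3
    define t where "t = s / (r + s)"
    have "t \<in> {0..1}" using x(1) y(1) 3 by (auto simp: t_def)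
    from ray_scale[OF ray_segment[OF x(2) y(2) 3(2) this], of "r + s"]
    have "ray (\<lambda>z. (r + s) * ((1 - t) * k x z + t * k y z))" .
    moreover have "(r + s) * ((1 - t) * k x z + t * k y z) = u z + v z" if "z \<in> P" for z
    proof -
      have "(r + s) * t = s" using 3 by (simp add: t_def)
      moreover then have "(r + s) * (1 - t) = r" by (simp add: algebra_simps)
      ultimately show ?thesis unfolding x(3)[OF that] y(3)[OF that]
        by (simp add: distrib_left flip: mult.assoc)
    qed
    ultimately show ?thesis unfolding ray_def by auto
  qed
qed

end

section \<open>Coordinates with respect to an orthonormal basis of three points\<close>

locale spherical_kernel_3 = spherical_kernel +
  fixes e1 e2 e3
  assumes e: "e1 \<in> P" "e2 \<in> P" "e3 \<in> P"
    and orth: "k e1 e2 = 0" "k e1 e3 = 0" "k e2 e3 = 0"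
    and complete: "\<And>y. y \<in> P \<Longrightarrow> k y e1 = 0 \<Longrightarrow> k y e2 = 0 \<Longrightarrow> k y e3 = 0 \<Longrightarrow> False"
begin

lemma gram: "k e1 e1 = 1" "k e2 e2 = 1" "k e3 e3 = 1" "k e2 e1 = 0" "k e3 e1 = 0" "k e3 e2 = 0"
  using e k_eq_1 k_sym orth by simp_all

lemma ray_combination: "ray (\<lambda>z. s1 * k e1 z + s2 * k e2 z + s3 * k e3 z)"
  by (intro ray_add ray_scale ray_point e)

text \<open>The residual of \<open>x\<close> after projection is a ray orthogonal to
  \<open>e1\<close>, \<open>e2\<close>, \<open>e3\<close>. A nonzero factor would give a point that
  \<open>complete\<close> forbids, so the residual is 0.\<close>

lemma k_expand:
  assumes x: "x \<in> P" and y: "y \<in> P"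
  shows "k x y = k x e1 * k y e1 + k x e2 * k y e2 + k x e3 * k y e3"
proof -
  \<comment> \<open>Subtraction is written as \<open>+ - 1 *\<close> so that \<open>ray_add\<close>
    and \<open>ray_scale\<close> apply.\<close>
  define w where "w z = k x z + - 1 * (k x e1 * k e1 z + k x e2 * k e2 z + k x e3 * k e3 z)" for z
  have "ray w" unfolding w_def by (intro ray_add ray_scale ray_point e x)
  then obtain r c where rc: "c \<in> P" "\<And>z. z \<in> P \<Longrightarrow> w z = r * k c z"
    unfolding ray_def by blast
  have "w e1 = 0" "w e2 = 0" "w e3 = 0" by (simp_all add: w_def gram orth)
  then have "r = 0" using rc(2)[OF e(1)] rc(2)[OF e(2)] rc(2)[OF e(3)] complete[OF rc(1)] by auto
  then have "w y = 0" using rc(2)[OF y] by simp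
  then show ?thesis using k_sym e y by (simp add: w_def)
qed

text \<open>The combination of \<open>e1\<close>, \<open>e2\<close>, \<open>e3\<close> with these
  coefficients is \<open>r * k c\<close> with nonnegative \<open>r\<close>. Both coefficient vectors
  have length 1, so \<open>r = 1\<close>.\<close>

lemma coordinates_surj:
  assumes "s1\<^sup>2 + s2\<^sup>2 + s3\<^sup>2 = 1"
  obtains x where "x \<in> P" "k x e1 = s1" "k x e2 = s2" "k x e3 = s3"
proof -
  obtain r c where rc: "0 \<le> r" "c \<in> P"
    "\<And>z. z \<in> P \<Longrightarrow> s1 * k e1 z + s2 * k e2 z + s3 * k e3 z = r * k c z"
    using ray_nonneg[OF ray_combination] by blast
  have s: "s1 = r * k c e1" "s2 = r * k c e2" "s3 = r * k c e3"
    using rc(3)[OF e(1)] rc(3)[OF e(2)] rc(3)[OF e(3)] by (simp_all add: gram orth)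
  have "k c e1 * k c e1 + k c e2 * k c e2 + k c e3 * k c e3 = 1"
    using k_expand[OF rc(2) rc(2)] k_eq_1[OF rc(2) rc(2)] by simp
  moreover have "s1\<^sup>2 + s2\<^sup>2 + s3\<^sup>2
      = r\<^sup>2 * (k c e1 * k c e1 + k c e2 * k c e2 + k c e3 * k c e3)"
    unfolding s by algebra
  ultimately have "r\<^sup>2 = 1" using assms by simp
  then have "r = 1" using rc(1) by (simp add: power2_eq_1_iff)
  then show thesis using that rc(2) s by simp
qed

lemma coordinates_unit:
  assumes "x \<in> P" shows "(k x e1)\<^sup>2 + (k x e2)\<^sup>2 + (k x e3)\<^sup>2 = 1"
  using k_expand[OF assms assms] k_eq_1[OF assms assms] by (simp add: power2_eq_square)

end

section \<open>Bloch vectors in \<complex>^2 and the Hopf fibration\<close>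

text \<open>The three Bloch components are the expectations of the Pauli matrices in
  \<open>v\<close>, without normalization.\<close>

definition bloch1 :: "complex^2 \<Rightarrow> real" where
  "bloch1 v = 2 * Re (cnj (v $ 1) * v $ 2)"

definition bloch2 :: "complex^2 \<Rightarrow> real" where
  "bloch2 v = 2 * Im (cnj (v $ 1) * v $ 2)"

definition bloch3 :: "complex^2 \<Rightarrow> real" where
  "bloch3 v = (cmod (v $ 1))\<^sup>2 - (cmod (v $ 2))\<^sup>2"

lemma norm_sq_vec2: "(norm (v :: complex^2))\<^sup>2 = (cmod (v $ 1))\<^sup>2 + (cmod (v $ 2))\<^sup>2"
  by (simp add: norm_vec_def L2_set_def sum_2)

lemma bloch_sq: "(bloch1 v)\<^sup>2 + (bloch2 v)\<^sup>2 + (bloch3 v)\<^sup>2 = ((norm v)\<^sup>2)\<^sup>2"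
  unfolding norm_sq_vec2 bloch1_def bloch2_def bloch3_def cmod_power2
  by (simp add: power2_eq_square algebra_simps)

text \<open>The bridge from Hermitian to real inner products: in terms of rank-one matrices it is
  the trace of a product expanded in Pauli matrices.\<close>

lemma cmod_herm_sq:
  "2 * (cmod (herm u v))\<^sup>2 =
    (norm u)\<^sup>2 * (norm v)\<^sup>2 + bloch1 u * bloch1 v + bloch2 u * bloch2 v + bloch3 u * bloch3 v"
  unfolding norm_sq_vec2 bloch1_def bloch2_def bloch3_def cmod_power2 herm_def sum_2
  by (simp add: power2_eq_square algebra_simps)

lemma lagrange_identity:
  "(cmod (u $ 1 * v $ 2 - u $ 2 * v $ 1))\<^sup>2 + (cmod (herm u v))\<^sup>2 = (norm u)\<^sup>2 * (norm v)\<^sup>2"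
  unfolding norm_sq_vec2 cmod_power2 herm_def sum_2
  by (simp add: power2_eq_square algebra_simps)

lemma bloch_scale:
  "bloch1 (c *s v) = (cmod c)\<^sup>2 * bloch1 v"
  "bloch2 (c *s v) = (cmod c)\<^sup>2 * bloch2 v"
  "bloch3 (c *s v) = (cmod c)\<^sup>2 * bloch3 v"
  unfolding bloch1_def bloch2_def bloch3_def cmod_power2
  by (simp_all add: power2_eq_square algebra_simps)

lemma norm_sq_scale: "(norm (c *s (v :: complex^2)))\<^sup>2 = (cmod c)\<^sup>2 * (norm v)\<^sup>2"
  by (simp add: norm_sq_vec2 norm_mult power_mult_distrib algebra_simps)

text \<open>By Lagrange's identity, equality in Cauchy-Schwarz kills the 2 by 2 determinant of
  \<open>v\<close> and \<open>w\<close>; the factor is read off a nonzero coordinate of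
  \<open>v\<close>.\<close>

lemma proportional_if_cauchy_schwarz_eq:
  assumes "v \<noteq> 0" "w \<noteq> 0" "(cmod (herm v w))\<^sup>2 = (norm v)\<^sup>2 * (norm w)\<^sup>2"
  shows "(v, w) \<in> proportional"
proof -
  have eq: "v $ 1 * w $ 2 = v $ 2 * w $ 1"
    using lagrange_identity[of v w] assms(3) by simp
  obtain c where c: "w = c *s v"
  proof (cases "v $ 1 = 0")
    case True
    with assms(1) have "v $ 2 \<noteq> 0" by (auto simp: vec_eq_iff forall_2)
    with True eq have "w = (w $ 2 / v $ 2) *s v" by (auto simp: vec_eq_iff forall_2)
    then show ?thesis using that by blast
  next
    case False
    with eq have "w = (w $ 1 / v $ 1) *s v" by (auto simp: vec_eq_iff forall_2 field_simps)
    then show ?thesis using that by blast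
  qed
  moreover have "c \<noteq> 0" using c assms(2) by auto
  ultimately show ?thesis using assms by (auto simp: proportional_def)
qed

text \<open>The fibre of the Hopf map over a point of the sphere. Multiplying by the squared norm
  keeps the conditions homogeneous, so the fibre contains vectors of every positive length.\<close>

definition bloch_fibre :: "real \<Rightarrow> real \<Rightarrow> real \<Rightarrow> (complex^2) set" where
  "bloch_fibre s1 s2 s3 = {v. v \<noteq> 0 \<and> bloch1 v = s1 * (norm v)\<^sup>2 \<and>
     bloch2 v = s2 * (norm v)\<^sup>2 \<and> bloch3 v = s3 * (norm v)\<^sup>2}"

lemma cmod_herm_bloch_fibre:
  assumes "u \<in> bloch_fibre s1 s2 s3" "v \<in> bloch_fibre t1 t2 t3"
  shows "2 * (cmod (herm u v))\<^sup>2 = (1 + s1 * t1 + s2 * t2 + s3 * t3) * ((norm u)\<^sup>2 * (norm v)\<^sup>2)"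
  using assms unfolding cmod_herm_sq bloch_fibre_def by (auto simp: algebra_simps)

text \<open>Over a unit vector the factor in \<open>cmod_herm_bloch_fibre\<close> is 2, so two
  vectors of the fibre attain equality in Cauchy-Schwarz.\<close>

lemma bloch_fibre_class:
  assumes v: "v \<in> bloch_fibre s1 s2 s3" and unit: "s1\<^sup>2 + s2\<^sup>2 + s3\<^sup>2 = 1"
  shows "bloch_fibre s1 s2 s3 = proportional `` {v}"
proof (rule set_eqI)
  fix w
  show "w \<in> bloch_fibre s1 s2 s3 \<longleftrightarrow> w \<in> proportional `` {v}"
  proof
    assume w: "w \<in> bloch_fibre s1 s2 s3"
    have "1 + s1 * s1 + s2 * s2 + s3 * s3 = 2" using unit by (simp add: power2_eq_square)
    with cmod_herm_bloch_fibre[OF v w] have "(cmod (herm v w))\<^sup>2 = (norm v)\<^sup>2 * (norm w)\<^sup>2"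
      by simp
    then show "w \<in> proportional `` {v}"
      using v w proportional_if_cauchy_schwarz_eq by (auto simp: bloch_fibre_def)
  next
    assume "w \<in> proportional `` {v}"
    then obtain c where "w \<noteq> 0" "w = c *s v" by (auto simp: proportional_def)
    then show "w \<in> bloch_fibre s1 s2 s3"
      using v by (auto simp: bloch_fibre_def bloch_scale norm_sq_scale)
  qed
qed

lemma bloch_fibre_nonempty:
  assumes unit: "s1\<^sup>2 + s2\<^sup>2 + s3\<^sup>2 = 1"
  obtains v where "v \<in> bloch_fibre s1 s2 s3"
proof (cases "s3 = - 1")
  case True
  then have "s1 = 0" "s2 = 0" using unit by (simp_all add: sum_power2_eq_zero_iff)
  with True have "vector [0, 1] \<in> bloch_fibre s1 s2 s3"
    by (auto simp: bloch_fibre_def bloch1_def bloch2_def bloch3_def norm_sq_vec2 vec_eq_iff forall_2)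
  then show ?thesis by (rule that)
next
  case False
  \<comment> \<open>Stereographic projection provides this preimage. It vanishes only at the pole
    \<open>s3 = - 1\<close>, whence the case split.\<close>
  define v :: "complex^2" where "v = vector [of_real (1 + s3), Complex s1 s2]"
  have v: "v $ 1 = of_real (1 + s3)" "v $ 2 = Complex s1 s2" by (simp_all add: v_def)
  have "v \<noteq> 0"
  proof
    assume "v = 0"
    then have "v $ 1 = 0" by simp
    with False show False unfolding v of_real_eq_0_iff by simp
  qed
  have N: "(norm v)\<^sup>2 = 2 * (1 + s3)"
    using unit unfolding norm_sq_vec2 v cmod_power2 by simp algebra
  have "bloch1 v = s1 * (2 * (1 + s3))" "bloch2 v = s2 * (2 * (1 + s3))"
    unfolding bloch1_def bloch2_def v by (simp_all add: algebra_simps)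
  moreover have "bloch3 v = s3 * (2 * (1 + s3))"
    using unit unfolding bloch3_def v cmod_power2 by simp algebra
  ultimately have "v \<in> bloch_fibre s1 s2 s3"
    using \<open>v \<noteq> 0\<close> N by (simp add: bloch_fibre_def)
  then show ?thesis by (rule that)
qed

lemma bloch_fibre_in_CP1:
  assumes "s1\<^sup>2 + s2\<^sup>2 + s3\<^sup>2 = 1" shows "bloch_fibre s1 s2 s3 \<in> CP1"
proof -
  obtain v where v: "v \<in> bloch_fibre s1 s2 s3" using bloch_fibre_nonempty[OF assms] .
  then have "v \<noteq> 0" by (simp add: bloch_fibre_def)
  then show ?thesis
    unfolding bloch_fibre_class[OF v assms] CP1_def by (simp add: quotientI)
qed

text \<open>The coordinates are the Bloch vector of a representative divided by its squared norm, a
  unit vector by \<open>bloch_sq\<close>.\<close>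

lemma bloch_fibre_exhausts_CP1:
  assumes "X \<in> CP1"
  obtains s1 s2 s3 where "s1\<^sup>2 + s2\<^sup>2 + s3\<^sup>2 = 1" "X = bloch_fibre s1 s2 s3"
proof -
  obtain v where v: "v \<noteq> 0" "X = proportional `` {v}"
    using assms by (auto simp: CP1_def elim: quotientE)
  let ?N = "(norm v)\<^sup>2"
  have N: "?N \<noteq> 0" using v(1) by simp
  have unit: "(bloch1 v / ?N)\<^sup>2 + (bloch2 v / ?N)\<^sup>2 + (bloch3 v / ?N)\<^sup>2 = 1"
    using N bloch_sq[of v] by (simp add: power_divide flip: add_divide_distrib)
  have "v \<in> bloch_fibre (bloch1 v / ?N) (bloch2 v / ?N) (bloch3 v / ?N)"
    using v(1) N by (simp add: bloch_fibre_def)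
  from bloch_fibre_class[OF this unit] show thesis using that unit v(2) by metis
qed

lemma herm_scaleR: "herm (a *\<^sub>R u) (b *\<^sub>R v) = of_real (a * b) * herm u v"
  by (simp add: herm_def sum_2 vector_scaleR_component) (simp add: scaleR_conv_of_real algebra_simps)

lemma cmod_herm_normalized:
  assumes "u \<noteq> 0" "v \<noteq> 0"
  shows "(cmod (herm (u /\<^sub>R norm u) (v /\<^sub>R norm v)))\<^sup>2
    = (cmod (herm u v))\<^sup>2 / ((norm u)\<^sup>2 * (norm v)\<^sup>2)"
  using assms
  by (simp only: herm_scaleR norm_mult norm_of_real power_mult_distrib power2_abs)
    (simp add: field_simps)

section \<open>The correspondence between points and complex lines\<close>

context spherical_kernel_3
begin

definition point_class :: "'a \<Rightarrow> (complex^2) set" where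
  "point_class x = bloch_fibre (k x e1) (k x e2) (k x e3)"

lemma cmod_herm_point_class:
  assumes "x \<in> P" "y \<in> P" "u \<in> point_class x" "v \<in> point_class y"
  shows "(cmod (herm (u /\<^sub>R norm u) (v /\<^sub>R norm v)))\<^sup>2 = (1 + k x y) / 2"
proof -
  have uv: "u \<noteq> 0" "v \<noteq> 0" using assms by (auto simp: point_class_def bloch_fibre_def)
  have "2 * (cmod (herm u v))\<^sup>2 = (1 + k x y) * ((norm u)\<^sup>2 * (norm v)\<^sup>2)"
    using cmod_herm_bloch_fibre[OF assms(3,4)[unfolded point_class_def]]
    by (simp add: k_expand[OF assms(1,2)] add.assoc)
  then show ?thesis unfolding cmod_herm_normalized[OF uv] using uv by (simp add: field_simps)
qed

text \<open>Injectivity: if \<open>x\<close> and \<open>y\<close> share a class, a common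
  representative gives \<open>k x y = k x x = 1\<close>. Surjectivity: every unit vector is the
  coordinate vector of a point.\<close>

lemma bij_betw_point_class: "bij_betw point_class P CP1"
proof (rule bij_betwI')
  fix x y assume xy: "x \<in> P" "y \<in> P"
  show "point_class x = point_class y \<longleftrightarrow> x = y"
  proof
    assume eq: "point_class x = point_class y"
    obtain v where v: "v \<in> point_class x"
      using bloch_fibre_nonempty[OF coordinates_unit[OF xy(1)]] unfolding point_class_def by blast
    then have "(1 + k x y) / 2 = (1 + k x x) / 2"
      using cmod_herm_point_class[OF xy(1) xy(1) v v] cmod_herm_point_class[OF xy v] eq by simp
    then show "x = y" using k_eq_1[OF xy] k_eq_1[OF xy(1) xy(1)] by simp
  qed simp
next
  fix x assume "x \<in> P"
  then show "point_class x \<in> CP1"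
    unfolding point_class_def by (intro bloch_fibre_in_CP1 coordinates_unit)
next
  fix X assume "X \<in> CP1"
  then obtain s1 s2 s3 where s: "s1\<^sup>2 + s2\<^sup>2 + s3\<^sup>2 = 1" "X = bloch_fibre s1 s2 s3"
    by (rule bloch_fibre_exhausts_CP1)
  obtain x where "x \<in> P" "k x e1 = s1" "k x e2 = s2" "k x e3 = s3"
    using coordinates_surj[OF s(1)] .
  then show "\<exists>x\<in>P. X = point_class x" using s(2) by (auto simp: point_class_def)
qed

end

section \<open>Application to a two-dimensional subspace of rank 2\<close>

sublocale two_dim \<subseteq> bloch: spherical_kernel P k
proof
  fix a b assume ab: "a \<in> P" "b \<in> P"
  then have S: "a \<in> S" "b \<in> S" using P_sub by auto
  show "\<bar>k a b\<bar> \<le> 1" using bounds[OF S] by (auto simp: k_def)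
  show "k a b = k b a" using p_sym[OF S] by (simp add: k_def)
  show "k a b = 1 \<longleftrightarrow> a = b" using p_eq_1[OF S] by (auto simp: k_def)
  show "\<exists>r. \<exists>c\<in>P. \<forall>z\<in>P. k a z + k b z = r * k c z" using midpoint[OF ab] .
next
  fix a assume a: "a \<in> P"
  obtain a' where a': "a' \<in> P" "p a a' = 0" using antipode_exists[OF a] by blast
  then have "k a' z = - k a z" if "z \<in> P" for z
    using orthog_complementary[OF a a' that] by (simp add: k_def)
  then show "\<exists>a'\<in>P. \<forall>z\<in>P. k a' z = - k a z" using a'(1) by blast
next
  fix s :: "nat \<Rightarrow> 'a" assume "range s \<subseteq> P"
  then show "\<exists>l\<in>P. \<exists>r. strict_mono r \<and> (\<forall>z\<in>P. (\<lambda>n. k (s (r n)) z) \<longlonglongrightarrow> k l z)"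
    by (metis k_convergent_subseq)
qed

theorem proposition6p1:
  fixes S :: "'a set" and p :: "'a \<Rightarrow> 'a \<Rightarrow> real" and P :: "'a set"
  assumes "\<And>x y. x \<in> S \<Longrightarrow> y \<in> S \<Longrightarrow> 0 \<le> p x y \<and> p x y \<le> 1"
    and "axiom_I S p" and "axiom_II S p" and "axiom_III S p" and "axiom_IV S p"
    and "two_dim_subspace S p P" and "has_rank p P 2"
  shows "\<exists>f :: 'a \<Rightarrow> (complex^2) set. bij_betw f P CP1 \<and>
    (\<forall>x1\<in>P. \<forall>x2\<in>P. \<forall>v1\<in>f x1. \<forall>v2\<in>f x2.
       p x1 x2 = (cmod (herm (v1 /\<^sub>R norm v1) (v2 /\<^sub>R norm v2)))\<^sup>2)"
proof -
  interpret transition_space S p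
    using assms(1-5) by unfold_locales
  obtain x x' where x: "x \<in> S" "x' \<in> S" "p x x' = 0" and P: "P = {z \<in> S. p x z + p x' z = 1}"
    using assms(6) by (auto simp: two_dim_subspace_def orthog_def)
  have "orthog_set S p {x, x'}"
    using x p_sym[OF x(1,2)] by (auto simp: orthog_set_def pairwise_insert orthog_def)
  then obtain F where F: "frame S p F" "{x, x'} \<subseteq> F"
    by (rule orthog_set_extends_to_frame)
  then have "insert x (insert x' (F - {x, x'})) = F" by blast
  then interpret two_dim S p P x x' "F - {x, x'}"
    using x P F(1) by unfold_locales auto
  obtain A where A: "A \<subseteq> P" "pairwise (equatorial p) A" "card A = 3"
    and max: "\<And>B. B \<subseteq> P \<Longrightarrow> pairwise (equatorial p) B \<Longrightarrow> card B \<le> 3"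
    using assms(7) by (auto simp: has_rank_def)
  obtain e1 e2 e3 where e: "A = {e1, e2, e3}" "e1 \<noteq> e2" "e1 \<noteq> e3" "e2 \<noteq> e3"
    using A(3) by (auto simp: card_3_iff)
  interpret spherical_kernel_3 P k e1 e2 e3
  proof
    show "e1 \<in> P" "e2 \<in> P" "e3 \<in> P" using A e by auto
    show "k e1 e2 = 0" "k e1 e3 = 0" "k e2 e3 = 0"
      using A(2) e by (auto simp: pairwise_def equatorial_def k_def)
    \<comment> \<open>Such a \<open>y\<close> would be equatorial to all of \<open>A\<close>, giving
      four mutually equatorial points, whereas rank 2 allows at most three.\<close>
    fix y assume y: "y \<in> P" "k y e1 = 0" "k y e2 = 0" "k y e3 = 0"
    have "k a a = 1" if "a \<in> P" for a using bloch.k_eq_1[OF that that] by simp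
    then have "y \<notin> A" using y e by auto
    have p_half: "p y a = 1/2" "p a y = 1/2" if "a \<in> A" for a
      using that y e p_sym[OF P_sub[OF y(1)] P_sub] A(1) by (auto simp: k_def)
    then have "pairwise (equatorial p) (insert y A)"
      using A(2) by (auto simp: pairwise_insert equatorial_def)
    then have "card (insert y A) \<le> 3" using y(1) A(1) by (intro max) auto
    then show False using \<open>y \<notin> A\<close> A(3) e(1) by simp
  qed
  show ?thesis
  proof (intro exI conjI ballI)
    show "bij_betw point_class P CP1" by (rule bij_betw_point_class)
    fix x1 x2 v1 v2
    assume "x1 \<in> P" "x2 \<in> P" "v1 \<in> point_class x1" "v2 \<in> point_class x2"
    from cmod_herm_point_class[OF this]
    show "p x1 x2 = (cmod (herm (v1 /\<^sub>R norm v1) (v2 /\<^sub>R norm v2)))\<^sup>2"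
      by (simp add: k_def)
  qed
qed

end
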